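(* Consider Brochette first-passage percolation in dimension $d=2$ with passage time distribution function $F$, and assume that the infimum $a$ of the support of this distribution equals $0$. Assume that there exist $C>0$ and $\beta\ge 0$ such that $F(t)\sim Ct^{\beta}$ as $t\to 0^+$, and that the passage times are bounded and their distribution is atomless. Then for every $x\in\mathbb{Z}^2\setminus\{0\}$ there exist $A_1,A_2>0$ such that for all integers $n\ge 2$: - if $\beta<1$, then $A_1\le \mathbb{E}[T(0,nx)]\le A_2$; - if $\beta=1$, then $A_1\log(n)\le \mathbb{E}[T(0,nx)]\le A_2\log(n)$; - if $\beta>1$, then $A_1 n^{1-\frac1\beta}\le \mathbb{E}[T(0,nx)]\le A_2 n^{1-\frac1\beta}$.
   Context: Brochette first-passage percolation on $\mathbb{Z}^2$: let $\mathbb{E}^2$ be the set of edges $\{x,y\}$ with $x,y\in\mathbb{Z}^2$, $\lVert x-y\rVert_1=1$. An integer line is the set of points of $\mathbb{Z}^2$ lying on a common line of $\mathbb{R}^2$ parallel to one of the coordinate axes; $\Delta$ is the set of integer lines. Let $(\tau_\delta)_{\delta\in\Delta}$ be i.i.d. random variables with values in $[0,+\infty)$ and common cumulative distribution function $F$. The passage time $\tau_e$ of an edge $e$ is $\tau_e=\tau_\delta$, where $\delta$ is the unique integer line containing both endpoints of $e$. The infimum $a\ge0$ of the support is characterized by $F(a+\eta)>0$ and $F(a-\eta)=0$ for all $\eta>0$. For $x,y\in\mathbb{Z}^2$, $T(x,y)=\inf_\Gamma\sum_{e\in\Gamma}\tau_e$, the infimum being over finite nearest-neighbour paths $\Gamma$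 from $x$ to $y$ (so $T(x,x)=0$). *)

theory Defs
  imports "HOL-Probability.Probability" "HOL-Library.Landau_Symbols" "HOL-Library.Product_Plus"
begin

type_synonym point = "int \<times> int"

definition l1_norm :: "point \<Rightarrow> int" where
  "l1_norm x = \<bar>fst x\<bar> + \<bar>snd x\<bar>"

definition edges :: "point set set" where
  "edges = {{x, y} | x y. l1_norm (x - y) = 1}"

definition integer_lines :: "point set set" where
  "integer_lines = range (\<lambda>c. {p. snd p = c}) \<union> range (\<lambda>c. {p. fst p = c})"

definition line_of :: "point set \<Rightarrow> point set" where
  "line_of e = (THE \<delta>. \<delta> \<in> integer_lines \<and> e \<subseteq> \<delta>)"

lemma ex1_line_of_edge:
  assumes "e \<in> edges"
  shows "\<exists>!\<delta>. \<delta> \<in> integer_lines \<and> e \<subseteq> \<delta>"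
proof -
  obtain a b c d :: int where e: "e = {(a, b), (c, d)}" and n: "\<bar>a - c\<bar> + \<bar>b - d\<bar> = 1"
    using assms by (auto simp: edges_def l1_norm_def)
  consider "a = c" "b \<noteq> d" | "b = d" "a \<noteq> c"
    using n by linarith
  then show ?thesis
  proof cases
    case 1
    then show ?thesis
      by (intro ex1I[of _ "{p. fst p = a}"]) (auto simp: e integer_lines_def)
  next
    case 2
    then show ?thesis
      by (intro ex1I[of _ "{p. snd p = b}"]) (auto simp: e integer_lines_def)
  qed
qed

text \<open>A path is given by the list of its successive vertices; the one-vertex list is the empty
  path from a point to itself.\<close>

definition path_edges :: "point list \<Rightarrow> point set list" where
  "path_edges p = map (\<lambda>(u, v). {u, v}) (zip (butlast p) (tl p))"

definition lattice_paths :: "point \<Rightarrow> point \<Rightarrow> point list set" where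
  "lattice_paths x y = {p. p \<noteq> [] \<and> hd p = x \<and> last p = y \<and> set (path_edges p) \<subseteq> edges}"

text \<open>Here \<open>t\<close> is a realisation of the line variables. For nonnegative \<open>t\<close> the infimum is over
  a nonempty set bounded below, so the real-valued \<^const>\<open>Inf\<close> is the true infimum.\<close>

definition edge_time :: "(point set \<Rightarrow> real) \<Rightarrow> point set \<Rightarrow> real" where
  "edge_time t e = t (line_of e)"

definition path_time :: "(point set \<Rightarrow> real) \<Rightarrow> point list \<Rightarrow> real" where
  "path_time t p = (\<Sum>e\<leftarrow>path_edges p. edge_time t e)"

definition first_passage_time :: "(point set \<Rightarrow> real) \<Rightarrow> point \<Rightarrow> point \<Rightarrow> real" where
  "first_passage_time t x y = (INF p\<in>lattice_paths x y. path_time t p)"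

locale brochette_fpp = prob_space M
  for M :: "'w measure" +
  fixes \<tau> :: "point set \<Rightarrow> 'w \<Rightarrow> real" and F :: "real \<Rightarrow> real"
  assumes indep: "indep_vars (\<lambda>_. borel) \<tau> integer_lines"
    and nonneg: "\<And>\<delta> \<omega>. \<delta> \<in> integer_lines \<Longrightarrow> \<omega> \<in> space M \<Longrightarrow> 0 \<le> \<tau> \<delta> \<omega>"
    and cdf: "\<And>\<delta>. \<delta> \<in> integer_lines \<Longrightarrow> cdf (distr M borel (\<tau> \<delta>)) = F"

definition support_infimum :: "(real \<Rightarrow> real) \<Rightarrow> real \<Rightarrow> bool" where
  "support_infimum F a \<longleftrightarrow> (\<forall>\<eta>>0. F (a + \<eta>) > 0 \<and> F (a - \<eta>) = 0)"

end

theory Submission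
  imports Defs "HOL-Real_Asymp.Real_Asymp"
begin

text \<open>
  The expected passage time turns out to be of the order of $\sum_{r \le n} r^{-1/\beta}$, and the three
  regimes are the three growths of this sum. The exponent enters through a single fact: the
  fastest of \<open>N\<close> lines has expected passage time of order $N^{-1/\beta}$
  (\<open>expectation_fastest_ge\<close>, \<open>expectation_fastest_le\<close>).

  \<^item> Lower bound. To get from \<open>\<ell>\<^sup>1\<close>-distance \<open>r - 1\<close> to \<open>\<ell>\<^sup>1\<close>-distance \<open>r\<close> of the origin, a path
    must use an edge on one of the at most \<open>6 r\<close> lines at distance at most \<open>r\<close> from the origin. So
    it pays at least the passage time of the fastest of these for every \<open>r \<le> n\<close>
    (\<open>path_time_ge_sum_Min\<close>), which costs about $r^{-1/\beta}$ on average.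

  \<^item> Upper bound. For \<open>k = 0, 1, 2, \<dots>\<close> let the traveller move from the crossing of the fastest row
    and the fastest column among the first \<open>2\<^sup>k\<close> of each to the corresponding crossing among the
    first \<open>2\<^bsup>k+1\<^esup>\<close>. Such a move has length of order \<open>2\<^sup>k\<close> and uses lines that are the fastest of at
    least \<open>2\<^sup>k\<close>. Doing this from both endpoints until the scale of their distance is reached, and
    joining the two halves along the fastest row, costs of order $\sum_k 2^k 2^{-k/\beta}$
    (\<open>two_sided_dyadic_route\<close>, \<open>expected_travel_le_dyadic_sum\<close>). A general target is reached by
    one horizontal and one vertical journey of this kind.

  The case \<open>\<beta> = 0\<close> is void: it would give the passage times an atom at \<open>0\<close> (\<open>exponent_pos\<close>).
\<close>

section \<open>Paths along integer lines\<close>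

definition hline :: "int \<Rightarrow> point set" where "hline c = {p. snd p = c}"

definition vline :: "int \<Rightarrow> point set" where "vline c = {p. fst p = c}"

lemma integer_lines_iff: "\<delta> \<in> integer_lines \<longleftrightarrow> (\<exists>c. \<delta> = hline c \<or> \<delta> = vline c)"
  by (auto simp: integer_lines_def hline_def vline_def)

lemma hline_integer_line [simp]: "hline c \<in> integer_lines"
  and vline_integer_line [simp]: "vline c \<in> integer_lines"
  by (auto simp: integer_lines_iff)

lemma inj_hline: "inj hline"
  by (rule injI) (metis (mono_tags) hline_def mem_Collect_eq snd_conv)

lemma inj_vline: "inj vline"
  by (rule injI) (metis (mono_tags) vline_def mem_Collect_eq fst_conv)

lemma line_of_eqI: "e \<in> edges \<Longrightarrow> \<delta> \<in> integer_lines \<Longrightarrow> e \<subseteq> \<delta> \<Longrightarrow> line_of e = \<delta>"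
  unfolding line_of_def using ex1_line_of_edge[of e] by (intro the1_equality) auto

lemma line_of_edge: "e \<in> edges \<Longrightarrow> line_of e \<in> integer_lines \<and> e \<subseteq> line_of e"
  unfolding line_of_def by (rule theI'[OF ex1_line_of_edge])

lemma path_edges_simps [simp]:
  "path_edges [] = []" "path_edges [u] = []"
  "path_edges (u # v # p) = {u, v} # path_edges (v # p)"
  by (simp_all add: path_edges_def)

lemma path_edges_append:
  "p \<noteq> [] \<Longrightarrow> path_edges (p @ q) = path_edges p @ path_edges (last p # q)"
  by (induction p rule: induct_list012) auto

lemma path_edges_rev: "path_edges (rev p) = rev (path_edges p)"
proof (induction p rule: induct_list012)
  case (3 u v p)
  have "path_edges (rev (v # p) @ [u]) = path_edges (rev (v # p)) @ [{v, u}]"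
    by (subst path_edges_append) auto
  with 3 show ?case
    by (simp add: insert_commute)
qed auto

text \<open>A cost bound witnessed by one path. Such bounds add up when paths are joined, so routes can be
  assembled piece by piece and the infimum over all paths is taken only at the end.\<close>

definition reachable_within :: "(point set \<Rightarrow> real) \<Rightarrow> point \<Rightarrow> point \<Rightarrow> real \<Rightarrow> bool" where
  "reachable_within t x y c \<longleftrightarrow> (\<exists>p\<in>lattice_paths x y. path_time t p \<le> c)"

lemma reachable_within_refl: "reachable_within t x x 0"
  unfolding reachable_within_def
  by (intro bexI[of _ "[x]"]) (auto simp: lattice_paths_def path_time_def)

lemma reachable_within_mono: "reachable_within t x y c \<Longrightarrow> c \<le> d \<Longrightarrow> reachable_within t x y d"
  unfolding reachable_within_def by force

lemma reachable_within_trans: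
  assumes "reachable_within t x y c" "reachable_within t y z d"
  shows "reachable_within t x z (c + d)"
proof -
  obtain p q where p: "p \<in> lattice_paths x y" "path_time t p \<le> c"
    and q: "q \<in> lattice_paths y z" "path_time t q \<le> d"
    using assms by (auto simp: reachable_within_def)
  obtain q' where q': "q = y # q'"
    using q by (cases q) (auto simp: lattice_paths_def)
  have "path_edges (p @ q') = path_edges p @ path_edges q"
    using p by (subst path_edges_append) (auto simp: lattice_paths_def q')
  then have "p @ q' \<in> lattice_paths x z" "path_time t (p @ q') \<le> c + d"
    using p q by (auto simp: lattice_paths_def path_time_def q' split: if_splits)
  then show ?thesis
    by (auto simp: reachable_within_def)
qed

lemma reachable_within_sym:
  assumes "reachable_within t x y c"
  shows "reachable_within t y x c"
proof -
  obtain p where p: "p \<in> lattice_paths x y" "path_time t p \<le> c"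
    using assms by (auto simp: reachable_within_def)
  then have "rev p \<in> lattice_paths y x" "path_time t (rev p) \<le> c"
    by (auto simp: lattice_paths_def path_time_def path_edges_rev hd_rev last_rev rev_map[symmetric])
  then show ?thesis
    by (auto simp: reachable_within_def)
qed

lemma reachable_within_edge:
  assumes "{u, v} \<in> edges" "\<delta> \<in> integer_lines" "u \<in> \<delta>" "v \<in> \<delta>"
  shows "reachable_within t u v (t \<delta>)"
  unfolding reachable_within_def using assms
  by (intro bexI[of _ "[u, v]"])
     (auto simp: lattice_paths_def path_time_def edge_time_def line_of_eqI)

lemma reachable_within_steps:
  fixes P :: "int \<Rightarrow> point"
  assumes step: "\<And>i. {P i, P (i + 1)} \<in> edges"
    and line: "\<delta> \<in> integer_lines" "range P \<subseteq> \<delta>"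
  shows "reachable_within t (P i) (P i') (of_int \<bar>i - i'\<bar> * t \<delta>)"
proof -
  have fwd: "reachable_within t (P i) (P (i + int k)) (real k * t \<delta>)" for i k
  proof (induction k)
    case 0
    then show ?case by (simp add: reachable_within_refl)
  next
    case (Suc k)
    have "reachable_within t (P (i + int k)) (P (i + int k + 1)) (t \<delta>)"
      using line by (intro reachable_within_edge step) auto
    from reachable_within_trans[OF Suc this] show ?case
      by (simp add: algebra_simps)
  qed
  show ?thesis
  proof (cases "i \<le> i'")
    case True
    then show ?thesis using fwd[of i "nat (i' - i)"] by simp
  next
    case False
    then show ?thesis using fwd[of i' "nat (i - i')"] reachable_within_sym by simp
  qed
qed

text \<open>The sign \<open>s\<close> lets one coordinate \<open>i\<close> describe travel to the right as well as to the left.\<close>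

lemma horizontal_travel:
  assumes s: "\<bar>s\<bar> = 1"
  shows "reachable_within t (a + s * i, b) (a + s * i', b) (of_int \<bar>i - i'\<bar> * t (hline b))"
proof (rule reachable_within_steps[where P = "\<lambda>i. (a + s * i, b)"])
  fix i
  have "l1_norm ((a + s * i, b) - (a + s * (i + 1), b)) = 1"
    using s by (simp add: l1_norm_def algebra_simps)
  then show "{(a + s * i, b), (a + s * (i + 1), b)} \<in> edges"
    unfolding edges_def by blast
qed (simp, auto simp: hline_def)

lemma vertical_travel:
  assumes s: "\<bar>s\<bar> = 1"
  shows "reachable_within t (a, b + s * i) (a, b + s * i') (of_int \<bar>i - i'\<bar> * t (vline a))"
proof (rule reachable_within_steps[where P = "\<lambda>i. (a, b + s * i)"])
  fix i
  have "l1_norm ((a, b + s * i) - (a, b + s * (i + 1))) = 1"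
    using s by (simp add: l1_norm_def algebra_simps)
  then show "{(a, b + s * i), (a, b + s * (i + 1))} \<in> edges"
    unfolding edges_def by blast
qed (simp, auto simp: vline_def)

lemma lattice_paths_nonempty: "lattice_paths x y \<noteq> {}"
proof -
  have "reachable_within (\<lambda>_. 0) x (fst x, snd y) 0"
    using vertical_travel[of 1 "\<lambda>_. 0" "fst x" 0 "snd x" "snd y"] by simp
  moreover have "reachable_within (\<lambda>_. 0) (fst x, snd y) y 0"
    using horizontal_travel[of 1 "\<lambda>_. 0" 0 "fst x" "snd y" "fst y"] by simp
  ultimately have "reachable_within (\<lambda>_. 0) x y (0 + 0)"
    by (rule reachable_within_trans)
  then show ?thesis
    by (auto simp: reachable_within_def)
qed

lemma path_time_nonneg:
  assumes "\<And>\<delta>. \<delta> \<in> integer_lines \<Longrightarrow> 0 \<le> t \<delta>" "p \<in> lattice_paths x y"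
  shows "0 \<le> path_time t p"
  using assms line_of_edge unfolding path_time_def edge_time_def lattice_paths_def
  by (intro sum_list_nonneg) auto

lemma bdd_below_path_times:
  assumes "\<And>\<delta>. \<delta> \<in> integer_lines \<Longrightarrow> 0 \<le> t \<delta>"
  shows "bdd_below (path_time t ` lattice_paths x y)"
proof (rule bdd_belowI2)
  show "0 \<le> path_time t p" if "p \<in> lattice_paths x y" for p
    using assms that by (rule path_time_nonneg)
qed

lemma first_passage_time_le:
  assumes "\<And>\<delta>. \<delta> \<in> integer_lines \<Longrightarrow> 0 \<le> t \<delta>" "reachable_within t x y c"
  shows "first_passage_time t x y \<le> c"
proof -
  obtain p where "p \<in> lattice_paths x y" "path_time t p \<le> c"
    using assms by (auto simp: reachable_within_def)
  moreover have "bdd_below (path_time t ` lattice_paths x y)"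
    using assms(1) by (rule bdd_below_path_times)
  ultimately show ?thesis
    unfolding first_passage_time_def by (auto intro: cINF_lower2)
qed

lemma first_passage_time_ge:
  assumes "\<And>p. p \<in> lattice_paths x y \<Longrightarrow> c \<le> path_time t p"
  shows "c \<le> first_passage_time t x y"
  unfolding first_passage_time_def using lattice_paths_nonempty assms by (rule cINF_greatest)

section \<open>Every path crosses all central shells\<close>

text \<open>Chosen so that every edge inside the \<open>\<ell>\<^sup>1\<close>-ball of radius \<open>r\<close> around the origin lies on one of
  these lines, while their number stays proportional to \<open>r\<close>.\<close>

definition central_lines :: "nat \<Rightarrow> point set set" where
  "central_lines r = hline ` {- int r..int r} \<union> vline ` {- int r..int r}"

lemma central_lines:
  "finite (central_lines r)" "central_lines r \<noteq> {}" "central_lines r \<subseteq> integer_lines"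
  by (auto simp: central_lines_def)

lemma card_central_lines: "1 \<le> r \<Longrightarrow> card (central_lines r) \<le> 6 * r"
proof -
  assume r: "1 \<le> r"
  have "card (central_lines r) \<le> card (hline ` {- int r..int r}) + card (vline ` {- int r..int r})"
    unfolding central_lines_def by (rule card_Un_le)
  also have "\<dots> \<le> card {- int r..int r} + card {- int r..int r}"
    by (intro add_mono card_image_le) auto
  also have "\<dots> \<le> 6 * r"
    using r by simp
  finally show ?thesis .
qed

text \<open>Each edge changes the \<open>\<ell>\<^sup>1\<close>-norm by at most one, so the path enters every shell between the
  norms of its endpoints from the shell just below. The edge by which it enters shell \<open>r\<close> ends at
  a point of norm \<open>r\<close>, hence lies on a line counted by \<open>central_lines r\<close>, and edges entering
  different shells are different. The induction removes the first edge: if it leads outwards, it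
  pays for exactly one shell; otherwise the rest of the path still enters every shell.\<close>

lemma path_time_ge_sum_Min:
  assumes nonneg: "\<And>\<delta>. \<delta> \<in> integer_lines \<Longrightarrow> 0 \<le> t \<delta>"
    and p: "p \<in> lattice_paths u z"
  shows "(\<Sum>r\<in>{nat (l1_norm u)<..nat (l1_norm z)}. Min (t ` central_lines r)) \<le> path_time t p"
  using p
proof (induction p arbitrary: u rule: induct_list012)
  case 1
  then show ?case by (simp add: lattice_paths_def)
next
  case (2 w)
  then show ?case by (auto simp: lattice_paths_def path_time_def)
next
  case (3 u' v p)
  have u': "u' = u" and e: "{u, v} \<in> edges" and vp: "v # p \<in> lattice_paths v z"
    using 3(3) by (auto simp: lattice_paths_def)
  let ?m = "\<lambda>r. Min (t ` central_lines r)"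
  have m0: "0 \<le> ?m r" for r
    using central_lines[of r] nonneg by (intro Min.boundedI) auto
  have IH: "(\<Sum>r\<in>{nat (l1_norm v)<..nat (l1_norm z)}. ?m r) \<le> path_time t (v # p)"
    using vp by (rule 3(2))
  have pt: "path_time t (u' # v # p) = t (line_of {u, v}) + path_time t (v # p)"
    by (simp add: u' path_time_def edge_time_def)
  have line: "line_of {u, v} \<in> integer_lines" "u \<in> line_of {u, v}" "v \<in> line_of {u, v}"
    using line_of_edge[OF e] by auto
  have "l1_norm (u - v) = 1"
    using e by (auto simp: edges_def l1_norm_def doubleton_eq_iff abs_minus_commute)
  then have le: "l1_norm v \<le> l1_norm u + 1"
    by (auto simp: l1_norm_def)
  have t0: "0 \<le> t (line_of {u, v})"
    using nonneg line by blast
  show ?case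
  proof (cases "l1_norm v \<le> l1_norm u")
    case True
    have "(\<Sum>r\<in>{nat (l1_norm u)<..nat (l1_norm z)}. ?m r)
        \<le> (\<Sum>r\<in>{nat (l1_norm v)<..nat (l1_norm z)}. ?m r)"
      using True m0 by (intro sum_mono2) auto
    with IH pt t0 show ?thesis by linarith
  next
    case False
    let ?r = "nat (l1_norm v)"
    have v: "l1_norm v = l1_norm u + 1" "0 \<le> l1_norm u"
      using False le by (auto simp: l1_norm_def)
    have "fst v \<in> {- int ?r..int ?r}" "snd v \<in> {- int ?r..int ?r}"
      by (auto simp: l1_norm_def)
    then have "hline (snd v) \<in> central_lines ?r" "vline (fst v) \<in> central_lines ?r"
      unfolding central_lines_def by blast+
    moreover obtain c where "line_of {u, v} = hline c \<or> line_of {u, v} = vline c"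
      using line(1) integer_lines_iff by blast
    then have "line_of {u, v} = hline (snd v) \<or> line_of {u, v} = vline (fst v)"
      using line(3) by (metis (mono_tags) hline_def vline_def mem_Collect_eq)
    ultimately have "line_of {u, v} \<in> central_lines ?r"
      by metis
    then have "?m ?r \<le> t (line_of {u, v})"
      using central_lines by (intro Min_le) auto
    moreover have "(\<Sum>r\<in>{nat (l1_norm u)<..nat (l1_norm z)}. ?m r)
        \<le> (\<Sum>r\<in>insert ?r {?r<..nat (l1_norm z)}. ?m r)"
      using v m0 by (intro sum_mono2) auto
    ultimately show ?thesis
      using IH pt by simp
  qed
qed

section \<open>A route along the fastest lines of dyadic blocks\<close>

lemma argmin_block:
  fixes f :: "int \<Rightarrow> real"
  obtains i where "i \<in> {0..<2 ^ K}" "f i = Min (f ` {0..<2 ^ K})"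
proof -
  have "Min (f ` {0..<2 ^ K}) \<in> f ` {0..<2 ^ K}"
    by (intro Min_in) auto
  then show ?thesis
    using that by (elim imageE) metis
qed

text \<open>The map \<open>P\<close> is a chart: \<open>P i j\<close> is where column \<open>i\<close> meets row \<open>j\<close>, with unit costs \<open>v i\<close> and
  \<open>h j\<close>. A chart may reflect the lattice, translate it or exchange its axes, so one proof serves all
  directions of travel.

  The statement speaks of every minimiser \<open>i\<close>, \<open>j\<close> at level \<open>K\<close>, rather than of some, because two
  routes that start from different points must be able to end on the same row. At level \<open>0\<close> a block
  consists of a single line, so the route starts on its minimisers at no cost. Passing from
  level \<open>k\<close> to \<open>k + 1\<close> uses the old fastest row and then the new fastest column, each for at most
  $2^{k+1}$ steps.\<close>

lemma dyadic_route:
  fixes P :: "int \<Rightarrow> int \<Rightarrow> point" and h v :: "int \<Rightarrow> real"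
  assumes row: "\<And>i i' j. reachable_within t (P i j) (P i' j) (of_int \<bar>i - i'\<bar> * h j)"
    and col: "\<And>i j j'. reachable_within t (P i j) (P i j') (of_int \<bar>j - j'\<bar> * v i)"
    and nonneg: "\<And>j. 0 \<le> h j" "\<And>i. 0 \<le> v i"
    and i: "i \<in> {0..<2 ^ K}" "v i = Min (v ` {0..<2 ^ K})"
    and j: "j \<in> {0..<2 ^ K}" "h j = Min (h ` {0..<2 ^ K})"
  shows "reachable_within t (P 0 0) (P i j)
    (\<Sum>k<K. 2 ^ Suc k * (Min (h ` {0..<2 ^ k}) + Min (v ` {0..<2 ^ Suc k})))"
  using i j
proof (induction K arbitrary: i j)
  case 0
  then have "i = 0" "j = 0" by auto
  then show ?case by (simp add: reachable_within_refl)
next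
  case (Suc K)
  obtain i0 where i0: "i0 \<in> {0..<2 ^ K}" "v i0 = Min (v ` {0..<2 ^ K})"
    by (rule argmin_block[of K v])
  obtain j0 where j0: "j0 \<in> {0..<2 ^ K}" "h j0 = Min (h ` {0..<2 ^ K})"
    by (rule argmin_block[of K h])
  have dist: "\<bar>k - k'\<bar> \<le> 2 ^ Suc K" if "k \<in> {0..<2 ^ K}" "k' \<in> {0..<2 ^ Suc K}" for k k' :: int
    using that by auto
  have "real_of_int \<bar>i0 - i\<bar> \<le> real_of_int (2 ^ Suc K)" "real_of_int \<bar>j0 - j\<bar> \<le> real_of_int (2 ^ Suc K)"
    using dist[OF i0(1) Suc.prems(1)] dist[OF j0(1) Suc.prems(3)] by linarith+
  then have "real_of_int \<bar>i0 - i\<bar> * h j0 \<le> 2 ^ Suc K * h j0"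
    and "real_of_int \<bar>j0 - j\<bar> * v i \<le> 2 ^ Suc K * v i"
    using nonneg by (auto intro!: mult_right_mono)
  then have "reachable_within t (P i0 j0) (P i j) (2 ^ Suc K * h j0 + 2 ^ Suc K * v i)"
    by (intro reachable_within_mono[OF reachable_within_trans[OF row col]] add_mono)
  from reachable_within_trans[OF Suc.IH[OF i0 j0] this] show ?case
    using j0 Suc.prems by (simp add: algebra_simps)
qed

text \<open>Both endpoints see the same blocks of rows, so the two dyadic routes can be directed to a common
  fastest row \<open>j\<close> of level \<open>K\<close>, which then bridges the remaining gap. The condition on \<open>K\<close>
  makes the last block comparable with the distance \<open>m\<close>, so that the bridge is no longer than a
  step of the next level; it is charged to the term \<open>k = K\<close> of the first sum.\<close>

lemma two_sided_dyadic_route: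
  fixes P :: "int \<Rightarrow> int \<Rightarrow> point" and h v :: "int \<Rightarrow> real"
  assumes row: "\<And>i i' j. reachable_within t (P i j) (P i' j) (of_int \<bar>i - i'\<bar> * h j)"
    and col: "\<And>i j j'. reachable_within t (P i j) (P i j') (of_int \<bar>j - j'\<bar> * v i)"
    and nonneg: "\<And>j. 0 \<le> h j" "\<And>i. 0 \<le> v i"
    and K: "2 ^ K \<le> m" "m < 2 ^ Suc K"
  shows "reachable_within t (P 0 0) (P m 0)
    (2 * (\<Sum>k\<le>K. 2 ^ Suc k * Min (h ` {0..<2 ^ k}))
      + (\<Sum>k<K. 2 ^ Suc k * Min (v ` {0..<2 ^ Suc k}))
      + (\<Sum>k<K. 2 ^ Suc k * Min ((\<lambda>i. v (m - i)) ` {0..<2 ^ Suc k})))"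
proof -
  obtain i where i: "i \<in> {0..<2 ^ K}" "v i = Min (v ` {0..<2 ^ K})"
    by (rule argmin_block[of K v])
  obtain i' where i': "i' \<in> {0..<2 ^ K}" "v (m - i') = Min ((\<lambda>i. v (m - i)) ` {0..<2 ^ K})"
    by (rule argmin_block[of K "\<lambda>i. v (m - i)"])
  obtain j where j: "j \<in> {0..<2 ^ K}" "h j = Min (h ` {0..<2 ^ K})"
    by (rule argmin_block[of K h])
  let ?H = "\<lambda>k. 2 ^ Suc k * Min (h ` {0..<2 ^ k})"
  let ?V = "\<lambda>k. 2 ^ Suc k * Min (v ` {0..<2 ^ Suc k})"
  let ?V' = "\<lambda>k. 2 ^ Suc k * Min ((\<lambda>i. v (m - i)) ` {0..<2 ^ Suc k})"
  have left: "reachable_within t (P 0 0) (P i j) (\<Sum>k<K. ?H k + ?V k)"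
    using dyadic_route[OF row col nonneg i j] by (simp add: algebra_simps)
  \<comment> \<open>The same lattice seen from the other endpoint, in the reflected chart.\<close>
  have row': "reachable_within t (P (m - a) b) (P (m - a') b) (of_int \<bar>a - a'\<bar> * h b)" for a a' b
    using row[of "m - a" b "m - a'"] by (simp add: abs_minus_commute)
  have "reachable_within t (P m 0) (P (m - i') j) (\<Sum>k<K. ?H k + ?V' k)"
    using dyadic_route[where P = "\<lambda>i. P (m - i)" and v = "\<lambda>i. v (m - i)", OF row' col nonneg i' j]
    by (simp add: algebra_simps)
  then have right: "reachable_within t (P (m - i') j) (P m 0) (\<Sum>k<K. ?H k + ?V' k)"
    by (rule reachable_within_sym)
  have "\<bar>i - (m - i')\<bar> \<le> 2 ^ Suc K"
    using i i' K by auto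
  then have "real_of_int \<bar>i - (m - i')\<bar> \<le> real_of_int (2 ^ Suc K)"
    by linarith
  then have "real_of_int \<bar>i - (m - i')\<bar> * h j \<le> 2 ^ Suc K * h j"
    using nonneg by (intro mult_right_mono) auto
  then have middle: "reachable_within t (P i j) (P (m - i') j) (?H K)"
    using reachable_within_mono[OF row] j by simp
  then show ?thesis
    by (intro reachable_within_mono[OF reachable_within_trans[OF left
            reachable_within_trans[OF middle right]]])
       (simp add: sum.distrib lessThan_Suc_atMost[symmetric] nonneg del: power_Suc)
qed

section \<open>The fastest of finitely many lines\<close>

lemma powr_inverse_exponent:
  fixes x \<beta> :: real
  assumes "0 < x" "\<beta> \<noteq> 0"
  shows "(x powr (- 1 / \<beta>)) powr \<beta> = 1 / x"
  unfolding powr_powr using assms by (simp add: powr_minus_divide)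

text \<open>The number of positive integers below \<open>y\<close> is at least \<open>y - 1\<close>. Taking expectations turns
  this into a bound of a mean by tail probabilities.\<close>

lemma le_one_plus_count_less:
  fixes y :: real
  assumes "y \<le> real L + 1"
  shows "y \<le> 1 + (\<Sum>l=1..L. of_bool (real l < y))"
  using assms
proof (induction L)
  case (Suc L)
  show ?case
  proof (cases "y \<le> real L + 1")
    case True
    with Suc.IH have "y \<le> 1 + (\<Sum>l=1..L. of_bool (real l < y))" by simp
    also have "\<dots> \<le> 1 + (\<Sum>l=1..Suc L. of_bool (real l < y))" by simp
    finally show ?thesis .
  next
    case False
    then have "(\<Sum>l=1..Suc L. of_bool (real l < y)) = (\<Sum>l=1..Suc L. 1 :: real)"
      by (intro sum.cong) auto
    with Suc.prems show ?thesis by simp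
  qed
qed simp

lemma summable_exp_neg_powr:
  assumes "0 < \<beta>"
  shows "summable (\<lambda>l. exp (- (real l powr \<beta>)))"
proof (rule summable_comparison_test_bigo)
  show "summable (\<lambda>l. norm (real l powr (-2)))"
    by (simp add: summable_real_powr_iff)
  show "(\<lambda>l. exp (- (real l powr \<beta>))) \<in> O(\<lambda>l. real l powr (-2))"
    using assms by real_asymp
qed

context brochette_fpp
begin

definition fastest :: "point set set \<Rightarrow> 'w \<Rightarrow> real" where
  "fastest S \<omega> = Min ((\<lambda>\<delta>. \<tau> \<delta> \<omega>) ` S)"

lemma line_time_measurable: "\<delta> \<in> integer_lines \<Longrightarrow> \<tau> \<delta> \<in> borel_measurable M"
  using indep by (auto simp: indep_vars_def)

lemma fastest_measurable:
  "finite S \<Longrightarrow> S \<subseteq> integer_lines \<Longrightarrow> fastest S \<in> borel_measurable M"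
  unfolding fastest_def[abs_def] using line_time_measurable by (intro borel_measurable_Min) auto

lemma fastest_nonneg:
  "finite S \<Longrightarrow> S \<noteq> {} \<Longrightarrow> S \<subseteq> integer_lines \<Longrightarrow> \<omega> \<in> space M \<Longrightarrow> 0 \<le> fastest S \<omega>"
  unfolding fastest_def using nonneg by (intro Min.boundedI) auto

lemma less_fastest_iff:
  "finite S \<Longrightarrow> S \<noteq> {} \<Longrightarrow> t < fastest S \<omega> \<longleftrightarrow> (\<forall>\<delta>\<in>S. t < \<tau> \<delta> \<omega>)"
  unfolding fastest_def by (subst Min_gr_iff) auto

lemma prob_line_time_le:
  assumes "\<delta> \<in> integer_lines"
  shows "prob {\<omega> \<in> space M. \<tau> \<delta> \<omega> \<le> t} = F t"
proof -
  have "F t = measure (distr M borel (\<tau> \<delta>)) {..t}"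
    using cdf[OF assms] by (simp add: cdf_def2[symmetric])
  also have "\<dots> = prob (\<tau> \<delta> -` {..t} \<inter> space M)"
    using line_time_measurable[OF assms] by (intro measure_distr) auto
  also have "\<tau> \<delta> -` {..t} \<inter> space M = {\<omega> \<in> space M. \<tau> \<delta> \<omega> \<le> t}"
    by auto
  finally show ?thesis ..
qed

lemma prob_line_time_gt:
  assumes "\<delta> \<in> integer_lines"
  shows "prob {\<omega> \<in> space M. t < \<tau> \<delta> \<omega>} = 1 - F t"
proof -
  note [measurable] = line_time_measurable[OF assms]
  have "prob (space M - {\<omega> \<in> space M. \<tau> \<delta> \<omega> \<le> t}) = 1 - F t"
    by (subst prob_compl) (simp_all add: prob_line_time_le[OF assms])
  also have "space M - {\<omega> \<in> space M. \<tau> \<delta> \<omega> \<le> t} = {\<omega> \<in> space M. t < \<tau> \<delta> \<omega>}"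
    by auto
  finally show ?thesis .
qed

text \<open>This is where independence of the lines enters.\<close>

lemma prob_fastest_gt:
  assumes S: "finite S" "S \<noteq> {}" "S \<subseteq> integer_lines"
  shows "prob {\<omega> \<in> space M. t < fastest S \<omega>} = (1 - F t) ^ card S"
proof -
  have "{\<omega> \<in> space M. t < fastest S \<omega>} = (\<Inter>\<delta>\<in>S. \<tau> \<delta> -` {t<..} \<inter> space M)"
    using S less_fastest_iff by auto
  also have "prob \<dots> = (\<Prod>\<delta>\<in>S. prob (\<tau> \<delta> -` {t<..} \<inter> space M))"
    using S by (intro indep_varsD[OF indep]) auto
  also have "\<dots> = (\<Prod>\<delta>\<in>S. 1 - F t)"
  proof (rule prod.cong)
    fix \<delta> assume "\<delta> \<in> S"
    moreover have "\<tau> \<delta> -` {t<..} \<inter> space M = {\<omega> \<in> space M. t < \<tau> \<delta> \<omega>}"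
      by auto
    ultimately show "prob (\<tau> \<delta> -` {t<..} \<inter> space M) = 1 - F t"
      using S prob_line_time_gt[of \<delta>] by auto
  qed simp
  finally show ?thesis by simp
qed

text \<open>A union bound, in the form of Bernoulli's inequality.\<close>

lemma prob_fastest_le_le:
  assumes S: "finite S" "S \<noteq> {}" "S \<subseteq> integer_lines"
  shows "prob {\<omega> \<in> space M. fastest S \<omega> \<le> t} \<le> real (card S) * F t"
proof -
  note [measurable] = fastest_measurable[OF S(1,3)]
  have F: "F t \<le> 1"
    using S prob_line_time_le[of _ t] by (metis all_not_in_conv prob_le_1 subsetD)
  have "{\<omega> \<in> space M. fastest S \<omega> \<le> t} = space M - {\<omega> \<in> space M. t < fastest S \<omega>}"
    by auto
  then have "prob {\<omega> \<in> space M. fastest S \<omega> \<le> t} = 1 - (1 - F t) ^ card S"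
    by (simp add: prob_compl prob_fastest_gt[OF S])
  also have "\<dots> \<le> real (card S) * F t"
    using Bernoulli_inequality[of "- F t" "card S"] F by simp
  finally show ?thesis .
qed

lemma integrable_fastest:
  assumes S: "finite S" "S \<noteq> {}" "S \<subseteq> integer_lines"
    and B: "\<And>\<delta>. \<delta> \<in> integer_lines \<Longrightarrow> AE \<omega> in M. \<tau> \<delta> \<omega> \<le> B"
  shows "AE \<omega> in M. fastest S \<omega> \<le> B" "integrable M (fastest S)"
proof -
  obtain \<delta> where \<delta>: "\<delta> \<in> S" using S by auto
  have "AE \<omega> in M. \<tau> \<delta> \<omega> \<le> B"
    using \<delta> S B by auto
  then show *: "AE \<omega> in M. fastest S \<omega> \<le> B"
    by eventually_elim (use S \<delta> in \<open>auto simp: fastest_def Min_le_iff\<close>)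
  have "AE \<omega> in M. norm (fastest S \<omega>) \<le> B"
    using * AE_space by eventually_elim (use fastest_nonneg[OF S] in auto)
  then show "integrable M (fastest S)"
    by (rule integrable_const_bound) (rule fastest_measurable[OF S(1,3)])
qed

text \<open>At $t = (2 \kappa N)^{-1/\beta}$, with \<open>N = card S\<close>, the union bound shows that some line is as
  fast as \<open>t\<close> with probability at most one half; Markov's inequality does the rest.\<close>

lemma expectation_fastest_ge:
  assumes S: "finite S" "S \<noteq> {}" "S \<subseteq> integer_lines"
    and int: "integrable M (fastest S)"
    and \<beta>: "0 < \<beta>" and \<kappa>: "0 < \<kappa>"
    and F: "\<And>t. 0 < t \<Longrightarrow> F t \<le> \<kappa> * t powr \<beta>"
  shows "1 / 2 * (2 * \<kappa>) powr (- 1 / \<beta>) * real (card S) powr (- 1 / \<beta>) \<le> expectation (fastest S)"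
proof -
  define t where "t = (2 * \<kappa> * real (card S)) powr (- 1 / \<beta>)"
  have N: "0 < real (card S)"
    using S by (simp add: card_gt_0_iff)
  have t: "0 < t"
    using \<kappa> N by (simp add: t_def)
  have "t powr \<beta> = 1 / (2 * \<kappa> * real (card S))"
    using \<beta> \<kappa> N powr_inverse_exponent[of "2 * \<kappa> * real (card S)" \<beta>] by (simp add: t_def)
  then have "real (card S) * F t \<le> 1 / 2"
    using mult_left_mono[OF F[OF t], of "real (card S)"] \<kappa> N by simp
  then have "prob {\<omega> \<in> space M. fastest S \<omega> \<le> t} \<le> 1 / 2"
    using prob_fastest_le_le[OF S, of t] by linarith
  moreover note [measurable] = fastest_measurable[OF S(1,3)]
  have "{\<omega> \<in> space M. t \<le> fastest S \<omega>} \<supseteq> space M - {\<omega> \<in> space M. fastest S \<omega> \<le> t}"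
    by auto
  then have "prob {\<omega> \<in> space M. t \<le> fastest S \<omega>} \<ge> prob (space M - {\<omega> \<in> space M. fastest S \<omega> \<le> t})"
    by (intro finite_measure_mono) auto
  then have "prob {\<omega> \<in> space M. t \<le> fastest S \<omega>} \<ge> 1 - prob {\<omega> \<in> space M. fastest S \<omega> \<le> t}"
    by (simp add: prob_compl)
  ultimately have half: "1 / 2 \<le> prob {\<omega> \<in> space M. t \<le> fastest S \<omega>}"
    by linarith
  have "prob {\<omega> \<in> space M. t \<le> fastest S \<omega>} \<le> expectation (fastest S) / t"
    using int t fastest_nonneg[OF S] by (intro integral_Markov_inequality_measure[where A = "{}"]) auto
  then have "t * prob {\<omega> \<in> space M. t \<le> fastest S \<omega>} \<le> expectation (fastest S)"
    using t by (simp add: field_simps)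
  with mult_left_mono[OF half, of t] have "t / 2 \<le> expectation (fastest S)"
    using t by linarith
  moreover have "t = (2 * \<kappa>) powr (- 1 / \<beta>) * real (card S) powr (- 1 / \<beta>)"
    using \<kappa> N by (simp add: t_def powr_mult)
  ultimately show ?thesis by simp
qed

text \<open>Measure the minimum in units of $s = (\kappa N)^{-1/\beta}$, with \<open>N = card S\<close>. By independence it
  exceeds \<open>l\<close> units with probability at most
  $(1 - F(sl))^N \le \exp(- N \kappa (sl)^\beta) = \exp(- l^\beta)$, a summable tail that does not
  depend on \<open>N\<close>. The bound on \<open>F\<close> is available only up to \<open>B\<close>, but beyond \<open>B\<close> there is no mass.\<close>

lemma expectation_fastest_le:
  assumes S: "finite S" "S \<noteq> {}" "S \<subseteq> integer_lines"
    and B: "\<And>\<delta>. \<delta> \<in> integer_lines \<Longrightarrow> AE \<omega> in M. \<tau> \<delta> \<omega> \<le> B"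
    and \<beta>: "0 < \<beta>" and \<kappa>: "0 < \<kappa>"
    and F: "\<And>t. 0 < t \<Longrightarrow> t \<le> B \<Longrightarrow> \<kappa> * t powr \<beta> \<le> F t"
  shows "expectation (fastest S)
    \<le> \<kappa> powr (- 1 / \<beta>) * (1 + (\<Sum>l. exp (- (real l powr \<beta>)))) * real (card S) powr (- 1 / \<beta>)"
proof -
  define N where "N = real (card S)"
  define s where "s = (\<kappa> * N) powr (- 1 / \<beta>)"
  have N: "0 < N"
    using S by (simp add: N_def card_gt_0_iff)
  have s: "0 < s" and s_powr: "\<kappa> * N * s powr \<beta> = 1"
    using \<beta> \<kappa> N powr_inverse_exponent[of "\<kappa> * N" \<beta>] by (simp_all add: s_def)
  note [measurable] = fastest_measurable[OF S(1,3)]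
  have le_B: "AE \<omega> in M. fastest S \<omega> \<le> B"
    using S B by (rule integrable_fastest)
  have tail: "prob {\<omega> \<in> space M. s * real l < fastest S \<omega>} \<le> exp (- (real l powr \<beta>))"
    if l: "1 \<le> l" for l
  proof (cases "s * real l \<le> B")
    case True
    have F1: "F (s * real l) \<le> 1"
      using S prob_line_time_le by (metis all_not_in_conv prob_le_1 subsetD)
    have "(1 - F (s * real l)) ^ card S \<le> exp (- F (s * real l)) ^ card S"
      using F1 exp_ge_add_one_self[of "- F (s * real l)"] by (intro power_mono) auto
    also have "\<dots> = exp (- (N * F (s * real l)))"
      by (simp add: N_def exp_of_nat_mult[symmetric])
    also have "\<dots> \<le> exp (- (N * (\<kappa> * (s * real l) powr \<beta>)))"
      using N F[of "s * real l"] True s l by simp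
    also have "N * (\<kappa> * (s * real l) powr \<beta>) = (\<kappa> * N * s powr \<beta>) * real l powr \<beta>"
      using s by (simp add: powr_mult)
    finally show ?thesis
      unfolding prob_fastest_gt[OF S] s_powr by simp
  next
    case False
    have "AE \<omega> in M. \<not> s * real l < fastest S \<omega>"
      using le_B by eventually_elim (use False in auto)
    then have "prob {\<omega> \<in> space M. s * real l < fastest S \<omega>} = 0"
      by (simp add: prob_eq_0)
    then show ?thesis by simp
  qed
  \<comment> \<open>Finitely many levels suffice because the minimum is bounded by \<open>B\<close>.\<close>
  define L where "L = nat \<lceil>B / s\<rceil>"
  have "B / s \<le> real L"
    unfolding L_def by linarith
  then have L: "B \<le> s * real L"
    using s by (simp add: field_simps)
  let ?I = "\<lambda>l. indicator {\<omega> \<in> space M. s * real l < fastest S \<omega>} :: 'w \<Rightarrow> real"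
  have I: "integrable M (?I l)" for l
    by (intro integrable_real_indicator) (auto simp: emeasure_eq_measure)
  have count: "integrable M (\<lambda>\<omega>. \<Sum>l=1..L. ?I l \<omega>)"
    using I by (intro Bochner_Integration.integrable_sum)
  have "expectation (fastest S) \<le> expectation (\<lambda>\<omega>. s * (1 + (\<Sum>l=1..L. ?I l \<omega>)))"
  proof (rule integral_mono_AE)
    show "integrable M (fastest S)"
      using S B by (rule integrable_fastest)
    show "AE \<omega> in M. fastest S \<omega> \<le> s * (1 + (\<Sum>l=1..L. ?I l \<omega>))"
      using le_B AE_space
    proof eventually_elim
      case (elim \<omega>)
      have "fastest S \<omega> / s \<le> 1 + (\<Sum>l=1..L. of_bool (real l < fastest S \<omega> / s))"
        using elim L s by (intro le_one_plus_count_less) (simp add: field_simps)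
      also have "(\<Sum>l=1..L. of_bool (real l < fastest S \<omega> / s)) = (\<Sum>l=1..L. ?I l \<omega>)"
        using elim s by (intro sum.cong) (auto simp: field_simps indicator_def)
      finally show ?case
        using s by (simp add: field_simps)
    qed
  qed (use count in simp)
  also have "\<dots> = s * (1 + (\<Sum>l=1..L. prob {\<omega> \<in> space M. s * real l < fastest S \<omega>}))"
    using count by (simp add: Bochner_Integration.integral_sum[OF I] prob_space)
  also have "\<dots> \<le> s * (1 + (\<Sum>l. exp (- (real l powr \<beta>))))"
  proof -
    have "(\<Sum>l=1..L. prob {\<omega> \<in> space M. s * real l < fastest S \<omega>}) \<le> (\<Sum>l=1..L. exp (- (real l powr \<beta>)))"
      using tail by (intro sum_mono) auto
    also have "\<dots> \<le> (\<Sum>l. exp (- (real l powr \<beta>)))"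
      using summable_exp_neg_powr[OF \<beta>] by (intro sum_le_suminf) auto
    finally show ?thesis
      using s by (intro mult_left_mono) auto
  qed
  also have "s = \<kappa> powr (- 1 / \<beta>) * N powr (- 1 / \<beta>)"
    using \<kappa> N by (simp add: s_def powr_mult)
  finally show ?thesis
    by (simp add: N_def mult_ac)
qed

section \<open>The distribution function near zero\<close>

lemma real_distribution_line_time: "\<delta> \<in> integer_lines \<Longrightarrow> real_distribution (distr M borel (\<tau> \<delta>))"
  using line_time_measurable by (rule real_distribution_distr)

lemma cdf_mono: "s \<le> t \<Longrightarrow> F s \<le> F t"
  using real_distribution_line_time[of "hline 0"] cdf[of "hline 0"]
  by (metis hline_integer_line finite_borel_measure.cdf_nondecreasing
      real_distribution.axioms(1) real_distribution.finite_borel_measure_M)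

lemma cdf_le_1: "F t \<le> 1"
  using prob_line_time_le[of "hline 0" t] by (metis hline_integer_line prob_le_1)

lemma cdf_near_0:
  assumes "C > 0" "F \<sim>[at_right 0] (\<lambda>t. C * t powr \<beta>)"
  obtains t0 where "0 < t0" "\<And>t. 0 < t \<Longrightarrow> t \<le> t0 \<Longrightarrow> C / 2 * t powr \<beta> \<le> F t"
    "\<And>t. 0 < t \<Longrightarrow> t \<le> t0 \<Longrightarrow> F t \<le> 2 * C * t powr \<beta>"
proof -
  let ?r = "\<lambda>t. if F t = 0 \<and> C * t powr \<beta> = 0 then 1 else F t / (C * t powr \<beta>)"
  have "(?r \<longlongrightarrow> 1) (at_right 0)"
    using assms by (intro asymp_equivD)
  then have "eventually (\<lambda>t. 1 / 2 < ?r t \<and> ?r t < 2) (at_right 0)"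
    by (intro eventually_conj order_tendstoD[where y = 1]) auto
  then obtain b where b: "0 < b" "\<And>t. 0 < t \<Longrightarrow> t < b \<Longrightarrow> 1 / 2 < ?r t \<and> ?r t < 2"
    by (auto simp: eventually_at_right_field)
  show thesis
  proof (rule that)
    show "0 < b / 2" using b by simp
    fix t assume t: "0 < t" "t \<le> b / 2"
    with b(1) have "t < b" by linarith
    with b(2)[OF t(1)] have "1 / 2 < F t / (C * t powr \<beta>)" "F t / (C * t powr \<beta>) < 2"
      using t assms(1) by auto
    then show "C / 2 * t powr \<beta> \<le> F t" "F t \<le> 2 * C * t powr \<beta>"
      using t assms(1) by (simp_all add: field_simps)
  qed
qed

text \<open>If \<open>\<beta> = 0\<close>, then \<open>F\<close> would stay near \<open>C > 0\<close> to the right of \<open>0\<close> while vanishing to the left.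
  An atomless distribution has a continuous distribution function, so this cannot happen.\<close>

lemma exponent_pos:
  assumes inf_supp: "support_infimum F 0" and C: "C > 0" and beta: "\<beta> \<ge> 0"
    and near_0: "F \<sim>[at_right 0] (\<lambda>t. C * t powr \<beta>)"
    and atomless: "\<forall>\<delta>\<in>integer_lines. \<forall>t. measure (distr M borel (\<tau> \<delta>)) {t} = 0"
  shows "0 < \<beta>"
proof (rule ccontr)
  assume "\<not> 0 < \<beta>"
  with beta have [simp]: "\<beta> = 0" by simp
  interpret D: real_distribution "distr M borel (\<tau> (hline 0))"
    by (rule real_distribution_line_time) simp
  have F: "cdf (distr M borel (\<tau> (hline 0))) = F"
    by (rule cdf) simp
  have "isCont F 0"
    using D.isCont_cdf[of 0] atomless unfolding F by simp
  then have cont: "(F \<longlongrightarrow> F 0) (at_left 0)" "(F \<longlongrightarrow> F 0) (at_right 0)"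
    by (auto simp: isCont_def filterlim_at_split)
  have "eventually (\<lambda>t. F t = 0) (at_left 0)"
    unfolding eventually_at_left_field
  proof (intro exI[of _ "- 1"] conjI allI impI)
    fix t :: real assume "t < 0"
    then show "F t = 0"
      using inf_supp by (auto simp: support_infimum_def dest!: spec[where x = "- t"])
  qed simp
  then have "(F \<longlongrightarrow> 0) (at_left 0)"
    by (rule tendsto_eventually)
  then have "F 0 = 0"
    using cont(1) by (intro tendsto_unique[of "at_left (0::real)"]) auto
  obtain t0 where t0: "0 < t0" "\<And>t. 0 < t \<Longrightarrow> t \<le> t0 \<Longrightarrow> C / 2 * t powr \<beta> \<le> F t"
    using cdf_near_0[OF C near_0] by metis
  then have "eventually (\<lambda>t. C / 2 \<le> F t) (at_right 0)"
    unfolding eventually_at_right_field by (intro exI[of _ t0]) auto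
  then have "C / 2 \<le> F 0"
    using cont(2) by (intro tendsto_lowerbound[of F _ "at_right 0"]) auto
  with C \<open>F 0 = 0\<close> show False by simp
qed

text \<open>Away from \<open>0\<close> the bound \<open>F t \<le> 1\<close> suffices, at the price of a larger constant.\<close>

lemma cdf_upper_bound:
  assumes \<beta>: "0 < \<beta>" and C: "C > 0" and near_0: "F \<sim>[at_right 0] (\<lambda>t. C * t powr \<beta>)"
  obtains \<kappa> where "0 < \<kappa>" "\<And>t. 0 < t \<Longrightarrow> F t \<le> \<kappa> * t powr \<beta>"
proof -
  obtain t0 where t0: "0 < t0" "\<And>t. 0 < t \<Longrightarrow> t \<le> t0 \<Longrightarrow> F t \<le> 2 * C * t powr \<beta>"
    using cdf_near_0[OF C near_0] by metis
  define \<kappa> where "\<kappa> = max (2 * C) (1 / t0 powr \<beta>)"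
  show thesis
  proof (rule that)
    show "0 < \<kappa>" using C by (simp add: \<kappa>_def)
    fix t :: real assume t: "0 < t"
    show "F t \<le> \<kappa> * t powr \<beta>"
    proof (cases "t \<le> t0")
      case True
      then have "F t \<le> 2 * C * t powr \<beta>" using t t0 by blast
      also have "\<dots> \<le> \<kappa> * t powr \<beta>" by (intro mult_right_mono) (auto simp: \<kappa>_def)
      finally show ?thesis .
    next
      case False
      have "F t \<le> 1" by (rule cdf_le_1)
      also have "1 \<le> 1 / t0 powr \<beta> * t powr \<beta>"
        using t0 False \<beta> powr_mono2[of \<beta> t0 t] by simp
      also have "\<dots> \<le> \<kappa> * t powr \<beta>" by (intro mult_right_mono) (auto simp: \<kappa>_def)
      finally show ?thesis .
    qed
  qed
qed

text \<open>Away from \<open>0\<close> monotonicity of \<open>F\<close> suffices, at the price of a smaller constant, as long as \<open>t\<close>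
  stays bounded.\<close>

lemma cdf_lower_bound:
  assumes \<beta>: "0 < \<beta>" and C: "C > 0" and near_0: "F \<sim>[at_right 0] (\<lambda>t. C * t powr \<beta>)"
    and B: "0 < B"
  obtains \<kappa> where "0 < \<kappa>" "\<And>t. 0 < t \<Longrightarrow> t \<le> B \<Longrightarrow> \<kappa> * t powr \<beta> \<le> F t"
proof -
  obtain t0 where t0: "0 < t0" "\<And>t. 0 < t \<Longrightarrow> t \<le> t0 \<Longrightarrow> C / 2 * t powr \<beta> \<le> F t"
    using cdf_near_0[OF C near_0] by metis
  define \<kappa> where "\<kappa> = min (C / 2) (C / 2 * t0 powr \<beta> / B powr \<beta>)"
  show thesis
  proof (rule that)
    show "0 < \<kappa>" using C t0 B by (simp add: \<kappa>_def)
    fix t :: real assume t: "0 < t" "t \<le> B"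
    show "\<kappa> * t powr \<beta> \<le> F t"
    proof (cases "t \<le> t0")
      case True
      have "\<kappa> * t powr \<beta> \<le> C / 2 * t powr \<beta>"
        by (intro mult_right_mono) (auto simp: \<kappa>_def)
      also have "\<dots> \<le> F t" using True t t0 by blast
      finally show ?thesis .
    next
      case False
      have "\<kappa> * t powr \<beta> \<le> \<kappa> * B powr \<beta>"
        using \<open>0 < \<kappa>\<close> t \<beta> by (intro mult_left_mono powr_mono2) auto
      also have "\<dots> \<le> C / 2 * t0 powr \<beta> / B powr \<beta> * B powr \<beta>"
        by (intro mult_right_mono) (auto simp: \<kappa>_def)
      also have "\<dots> = C / 2 * t0 powr \<beta>" using B by simp
      also have "\<dots> \<le> F t0" using t0 by blast
      also have "\<dots> \<le> F t" using False by (intro cdf_mono) simp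
      finally show ?thesis .
    qed
  qed
qed

end

section \<open>Growth rates\<close>

definition growth_rate :: "real \<Rightarrow> nat \<Rightarrow> real" where
  "growth_rate \<beta> n = (if \<beta> < 1 then 1 else if \<beta> = 1 then ln (real n) else real n powr (1 - 1 / \<beta>))"

lemma growth_rate_nonneg: "1 \<le> n \<Longrightarrow> 0 \<le> growth_rate \<beta> n"
  by (simp add: growth_rate_def)

text \<open>The first term alone suffices for \<open>\<beta> < 1\<close>, and for \<open>\<beta> > 1\<close> each of the \<open>n\<close> terms is at least the last.
  At \<open>\<beta> = 1\<close> the sum is harmonic.\<close>

lemma growth_rate_le_sum:
  assumes "0 < \<beta>" "1 \<le> n"
  shows "growth_rate \<beta> n \<le> (\<Sum>r=1..n. real r powr (- 1 / \<beta>))"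
proof -
  consider "\<beta> < 1" | "\<beta> = 1" | "\<beta> > 1" by linarith
  then show ?thesis
  proof cases
    case 1
    have "(\<Sum>r=1..1. real r powr (- 1 / \<beta>)) \<le> (\<Sum>r=1..n. real r powr (- 1 / \<beta>))"
      using assms by (intro sum_mono2) auto
    with 1 show ?thesis by (simp add: growth_rate_def)
  next
    case 2
    have "ln (real n) \<le> ln (real n + 1)"
      using assms by simp
    also have "\<dots> \<le> harm n"
      by (rule ln_le_harm)
    also have "harm n = (\<Sum>r=1..n. real r powr (- 1 / \<beta>))"
      unfolding harm_def 2 by (intro sum.cong) (auto simp: powr_minus)
    finally show ?thesis
      by (simp add: growth_rate_def 2)
  next
    case 3
    have "growth_rate \<beta> n = (\<Sum>r=1..n. real n powr (- 1 / \<beta>))"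
      using 3 assms powr_add[of "real n" 1 "- 1 / \<beta>"] by (simp add: growth_rate_def)
    also have "\<dots> \<le> (\<Sum>r=1..n. real r powr (- 1 / \<beta>))"
      using assms by (intro sum_mono powr_mono2') auto
    finally show ?thesis .
  qed
qed

text \<open>The sum is geometric with ratio $q = 2^{1 - 1/\beta}$, which is below, equal to or above one in
  the three regimes: the sum is bounded, or counts its terms, or is dominated by its last term
  $q^K = (2^K)^{1 - 1/\beta}$.\<close>

lemma dyadic_sum_le_growth_rate:
  fixes L :: nat
  assumes \<beta>: "0 < \<beta>" and L: "1 \<le> L"
  shows "\<exists>D\<ge>0. \<forall>n\<ge>2. \<forall>K. 2 ^ K \<le> n * L \<longrightarrow>
    (\<Sum>k\<le>K. 2 ^ k * (2 ^ k) powr (- 1 / \<beta>)) \<le> D * growth_rate \<beta> n"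
proof -
  define q :: real where "q = 2 powr (1 - 1 / \<beta>)"
  have term_eq: "2 ^ k * (2 ^ k) powr (- 1 / \<beta>) = q ^ k" for k
    by (simp add: q_def powr_realpow[symmetric] powr_powr powr_add[symmetric] algebra_simps)
  have q: "0 < q" by (simp add: q_def)
  consider "\<beta> < 1" | "\<beta> = 1" | "\<beta> > 1" by linarith
  then show ?thesis
  proof cases
    case 1
    have "q < 2 powr 0"
      unfolding q_def using 1 \<beta> by (intro powr_less_mono) auto
    then have q1: "q < 1" by simp
    have "(\<Sum>k\<le>K. q ^ k) \<le> 1 / (1 - q)" for K
      using q q1 by (simp add: sum_gp0 divide_right_mono)
    then show ?thesis
      using 1 q1 by (intro exI[of _ "1 / (1 - q)"]) (simp only: term_eq growth_rate_def, simp)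
  next
    case 2
    \<comment> \<open>From $K \le \log_2 n + \log_2 L$; since \<open>log\<^sub>2 n \<ge> 1\<close>, the constants \<open>1\<close> and \<open>log\<^sub>2 L\<close> are absorbed
      by multiplying them with \<open>log\<^sub>2 n\<close>.\<close>
    let ?D = "2 / ln 2 + ln (real L) / (ln 2)\<^sup>2"
    have "1 + real K \<le> ?D * ln (real n)" if n: "2 \<le> n" and K: "2 ^ K \<le> n * L" for n K :: nat
    proof -
      have "real (2 ^ K) \<le> real (n * L)"
        using K by (simp only: of_nat_le_iff)
      then have "ln (2 ^ K) \<le> ln (real n * real L)"
        using n L by (subst ln_le_cancel_iff) auto
      then have "real K * ln 2 \<le> ln (real n) + ln (real L)"
        using n L by (simp add: ln_realpow ln_mult)
      then have "real K \<le> ln (real n) / ln 2 + ln (real L) / ln 2"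
        by (simp add: field_simps)
      moreover have n2: "1 \<le> ln (real n) / ln 2"
        using n by simp
      moreover have "ln (real L) / ln 2 \<le> ln (real L) / ln 2 * (ln (real n) / ln 2)"
        using mult_left_mono[OF n2, of "ln (real L) / ln 2"] L by simp
      moreover have "?D * ln (real n)
          = 2 * (ln (real n) / ln 2) + ln (real L) / ln 2 * (ln (real n) / ln 2)"
        by (simp add: field_simps power2_eq_square)
      ultimately show ?thesis
        by linarith
    qed
    then show ?thesis
      using 2 L unfolding term_eq by (intro exI[of _ ?D]) (auto simp: growth_rate_def q_def)
  next
    case 3
    have "2 powr 0 < q"
      unfolding q_def using 3 by (intro powr_less_mono) auto
    then have q1: "1 < q" by simp
    let ?D = "q / (q - 1) * real L powr (1 - 1 / \<beta>)"
    have "(\<Sum>k\<le>K. q ^ k) \<le> ?D * real n powr (1 - 1 / \<beta>)"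
      if n: "2 \<le> n" and K: "2 ^ K \<le> n * L" for n K :: nat
    proof -
      have "real (2 ^ K) \<le> real (n * L)"
        using K by (simp only: of_nat_le_iff)
      then have "(2 ^ K) powr (1 - 1 / \<beta>) \<le> (real n * real L) powr (1 - 1 / \<beta>)"
        using 3 by (intro powr_mono2) auto
      moreover have "(2 ^ K) powr (1 - 1 / \<beta>) = q ^ K"
        using powr_powr_swap[of 2 "real K" "1 - 1 / \<beta>"] by (simp add: q_def powr_realpow)
      ultimately have qK: "q ^ K \<le> real n powr (1 - 1 / \<beta>) * real L powr (1 - 1 / \<beta>)"
        by (simp add: powr_mult)
      have "(\<Sum>k\<le>K. q ^ k) = (q * q ^ K - 1) / (q - 1)"
        using q1 by (simp add: sum_gp0 divide_simps) (simp add: algebra_simps)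
      also have "\<dots> \<le> q / (q - 1) * q ^ K"
        using q1 by (simp add: divide_right_mono)
      also have "\<dots> \<le> q / (q - 1) * (real n powr (1 - 1 / \<beta>) * real L powr (1 - 1 / \<beta>))"
        using q1 qK by (intro mult_left_mono) auto
      finally show ?thesis by (simp add: mult_ac)
    qed
    then show ?thesis
      using 3 q1 unfolding term_eq by (intro exI[of _ ?D]) (auto simp: growth_rate_def)
  qed
qed

section \<open>Expected travel costs\<close>

context brochette_fpp
begin

text \<open>The random budget \<open>Z\<close> keeps the bound usable before anything is known about measurability or
  integrability of passage times, and lets bounds for successive journeys be added.\<close>

definition expected_travel_le :: "point \<Rightarrow> point \<Rightarrow> real \<Rightarrow> bool" where
  "expected_travel_le x y c \<longleftrightarrow> (\<exists>Z. integrable M Z \<and>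
    (\<forall>\<omega>\<in>space M. reachable_within (\<lambda>\<delta>. \<tau> \<delta> \<omega>) x y (Z \<omega>)) \<and> expectation Z \<le> c)"

lemma expected_travel_le_refl: "0 \<le> c \<Longrightarrow> expected_travel_le x x c"
  unfolding expected_travel_le_def
  by (intro exI[of _ "\<lambda>_. 0"]) (simp add: reachable_within_refl)

lemma expected_travel_le_mono: "expected_travel_le x y c \<Longrightarrow> c \<le> d \<Longrightarrow> expected_travel_le x y d"
  unfolding expected_travel_le_def by force

lemma expected_travel_le_trans:
  assumes "expected_travel_le x y c" "expected_travel_le y z d"
  shows "expected_travel_le x z (c + d)"
proof -
  obtain Y Z where "integrable M Y" "expectation Y \<le> c" "integrable M Z" "expectation Z \<le> d"
    and "\<forall>\<omega>\<in>space M. reachable_within (\<lambda>\<delta>. \<tau> \<delta> \<omega>) x y (Y \<omega>)"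
    and "\<forall>\<omega>\<in>space M. reachable_within (\<lambda>\<delta>. \<tau> \<delta> \<omega>) y z (Z \<omega>)"
    using assms unfolding expected_travel_le_def by auto
  then show ?thesis
    unfolding expected_travel_le_def
    by (intro exI[of _ "\<lambda>\<omega>. Y \<omega> + Z \<omega>"]) (auto intro: reachable_within_trans)
qed

lemma path_time_measurable:
  assumes "p \<in> lattice_paths x y"
  shows "(\<lambda>\<omega>. path_time (\<lambda>\<delta>. \<tau> \<delta> \<omega>) p) \<in> borel_measurable M"
proof -
  have "(\<lambda>\<omega>. \<Sum>e\<leftarrow>es. \<tau> (line_of e) \<omega>) \<in> borel_measurable M" if "set es \<subseteq> edges" for es
    using that
  proof (induction es)
    case (Cons e es)
    have "\<tau> (line_of e) \<in> borel_measurable M"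
      using Cons.prems line_of_edge[of e] line_time_measurable by auto
    with Cons show ?case by simp
  qed simp
  then show ?thesis
    using assms by (simp add: path_time_def edge_time_def lattice_paths_def)
qed

text \<open>The infimum is over countably many paths.\<close>

lemma first_passage_time_measurable:
  "(\<lambda>\<omega>. first_passage_time (\<lambda>\<delta>. \<tau> \<delta> \<omega>) x y) \<in> borel_measurable M"
  unfolding first_passage_time_def
  using path_time_measurable by (intro borel_measurable_cINF_real countableI_type) auto

lemma first_passage_time_nonneg: "\<omega> \<in> space M \<Longrightarrow> 0 \<le> first_passage_time (\<lambda>\<delta>. \<tau> \<delta> \<omega>) x y"
  using nonneg by (intro first_passage_time_ge path_time_nonneg) auto

lemma expectation_first_passage_time_le:
  assumes "expected_travel_le x y c"
  shows "integrable M (\<lambda>\<omega>. first_passage_time (\<lambda>\<delta>. \<tau> \<delta> \<omega>) x y)"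
    and "expectation (\<lambda>\<omega>. first_passage_time (\<lambda>\<delta>. \<tau> \<delta> \<omega>) x y) \<le> c"
proof -
  obtain Z where Z: "integrable M Z" "expectation Z \<le> c"
    and reach: "\<And>\<omega>. \<omega> \<in> space M \<Longrightarrow> reachable_within (\<lambda>\<delta>. \<tau> \<delta> \<omega>) x y (Z \<omega>)"
    using assms unfolding expected_travel_le_def by auto
  have le: "first_passage_time (\<lambda>\<delta>. \<tau> \<delta> \<omega>) x y \<le> Z \<omega>" if "\<omega> \<in> space M" for \<omega>
    using nonneg that reach by (intro first_passage_time_le) auto
  show int: "integrable M (\<lambda>\<omega>. first_passage_time (\<lambda>\<delta>. \<tau> \<delta> \<omega>) x y)"
  proof (rule Bochner_Integration.integrable_bound[OF Z(1) first_passage_time_measurable], rule AE_I2)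
    fix \<omega> assume "\<omega> \<in> space M"
    then show "norm (first_passage_time (\<lambda>\<delta>. \<tau> \<delta> \<omega>) x y) \<le> norm (Z \<omega>)"
      using le[of \<omega>] first_passage_time_nonneg[of \<omega> x y] by simp
  qed
  have "expectation (\<lambda>\<omega>. first_passage_time (\<lambda>\<delta>. \<tau> \<delta> \<omega>) x y) \<le> expectation Z"
    using int Z(1) le by (rule integral_mono)
  with Z(2) show "expectation (\<lambda>\<omega>. first_passage_time (\<lambda>\<delta>. \<tau> \<delta> \<omega>) x y) \<le> c"
    by linarith
qed

text \<open>Taking expectations in \<open>two_sided_dyadic_route\<close>: at scale \<open>k\<close> the row term contributes twice
  \<open>2 c\<close> times $2^k (2^k)^{-1/\beta}$ and each of the two column sums contributes \<open>c\<close> times the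
  next such term, whence the factor \<open>6\<close>.\<close>

lemma expected_travel_le_dyadic_sum:
  fixes P :: "int \<Rightarrow> int \<Rightarrow> point" and h v :: "int \<Rightarrow> point set"
  assumes row: "\<And>t i i' j. reachable_within t (P i j) (P i' j) (of_int \<bar>i - i'\<bar> * t (h j))"
    and col: "\<And>t i j j'. reachable_within t (P i j) (P i j') (of_int \<bar>j - j'\<bar> * t (v i))"
    and lines: "inj h" "inj v" "range h \<subseteq> integer_lines" "range v \<subseteq> integer_lines"
    and c0: "0 \<le> c"
    and c: "\<And>S. finite S \<Longrightarrow> S \<noteq> {} \<Longrightarrow> S \<subseteq> integer_lines \<Longrightarrow>
      integrable M (fastest S) \<and> expectation (fastest S) \<le> c * real (card S) powr (- 1 / \<beta>)"
    and K: "2 ^ K \<le> m" "m < 2 ^ Suc K"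
  shows "expected_travel_le (P 0 0) (P m 0) (6 * c * (\<Sum>k\<le>K. 2 ^ k * (2 ^ k) powr (- 1 / \<beta>)))"
proof -
  define H V V' where "H k = h ` {0..<2 ^ k}" and "V k = v ` {0..<2 ^ k}"
    and "V' k = (\<lambda>i. v (m - i)) ` {0..<2 ^ k}" for k :: nat
  have V'_inj: "inj (\<lambda>i. v (m - i))"
    using lines(2) by (intro injI) (simp add: inj_eq)
  have card: "card (H k) = 2 ^ k" "card (V k) = 2 ^ k" "card (V' k) = 2 ^ k" for k
    unfolding H_def V_def V'_def using lines V'_inj
    by (subst card_image; auto intro: inj_on_subset simp: nat_power_eq)+
  have good: "integrable M (fastest S)" "expectation (fastest S) \<le> c * (2 ^ k) powr (- 1 / \<beta>)"
    if "S \<in> {H k, V k, V' k}" for S k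
  proof -
    have "finite S \<and> S \<noteq> {} \<and> S \<subseteq> integer_lines" "card S = 2 ^ k"
      using that lines card by (auto simp: H_def V_def V'_def)
    with c[of S] show "integrable M (fastest S)"
      "expectation (fastest S) \<le> c * (2 ^ k) powr (- 1 / \<beta>)" by auto
  qed
  define Z where "Z \<omega> = 2 * (\<Sum>k\<le>K. 2 ^ Suc k * fastest (H k) \<omega>)
      + (\<Sum>k<K. 2 ^ Suc k * fastest (V (Suc k)) \<omega>)
      + (\<Sum>k<K. 2 ^ Suc k * fastest (V' (Suc k)) \<omega>)" for \<omega>
  let ?f = "\<lambda>k. 2 ^ k * (2 ^ k) powr (- 1 / \<beta>) :: real"
  have int: "integrable M (\<lambda>\<omega>. 2 ^ Suc k * fastest (H k) \<omega>)"
    "integrable M (\<lambda>\<omega>. 2 ^ k * fastest (V k) \<omega>)"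
    "integrable M (\<lambda>\<omega>. 2 ^ k * fastest (V' k) \<omega>)" for k
    by (intro integrable_mult_right good(1)[of _ k]; simp)+
  have "integrable M Z"
    unfolding Z_def using int
    by (intro Bochner_Integration.integrable_add integrable_mult_right
          Bochner_Integration.integrable_sum) (auto simp del: power_Suc)
  moreover have "\<forall>\<omega>\<in>space M. reachable_within (\<lambda>\<delta>. \<tau> \<delta> \<omega>) (P 0 0) (P m 0) (Z \<omega>)"
  proof
    fix \<omega> assume \<omega>: "\<omega> \<in> space M"
    have "0 \<le> \<tau> (h j) \<omega>" "0 \<le> \<tau> (v j) \<omega>" for j
      using lines nonneg \<omega> by auto
    from two_sided_dyadic_route[OF row col this K]
    show "reachable_within (\<lambda>\<delta>. \<tau> \<delta> \<omega>) (P 0 0) (P m 0) (Z \<omega>)"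
      unfolding Z_def fastest_def H_def V_def V'_def image_image .
  qed
  moreover have "expectation Z \<le> 6 * c * (\<Sum>k\<le>K. ?f k)"
  proof -
    \<comment> \<open>The column sums run over the terms of index \<open>1\<close> to \<open>K\<close>.\<close>
    have shift: "(\<Sum>k<K. c * ?f (Suc k)) \<le> (\<Sum>k\<le>K. c * ?f k)"
    proof -
      have "(\<Sum>k\<le>K. c * ?f k) = c * ?f 0 + (\<Sum>k<K. c * ?f (Suc k))"
        by (simp only: lessThan_Suc_atMost[symmetric] sum.lessThan_Suc_shift)
      moreover have "0 \<le> c * ?f 0"
        using c0 by simp
      ultimately show ?thesis by linarith
    qed
    have "expectation Z = 2 * (\<Sum>k\<le>K. 2 ^ Suc k * expectation (fastest (H k)))
      + (\<Sum>k<K. 2 ^ Suc k * expectation (fastest (V (Suc k))))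
      + (\<Sum>k<K. 2 ^ Suc k * expectation (fastest (V' (Suc k))))"
      unfolding Z_def using int
      by (simp add: Bochner_Integration.integral_sum Bochner_Integration.integral_add del: power_Suc)
    also have "\<dots> \<le> 2 * (\<Sum>k\<le>K. 2 * (c * ?f k)) + (\<Sum>k<K. c * ?f (Suc k)) + (\<Sum>k<K. c * ?f (Suc k))"
    proof -
      have times: "2 ^ k * expectation (fastest S) \<le> c * ?f k" if "S \<in> {H k, V k, V' k}" for S k
        using mult_left_mono[OF good(2)[OF that], of "2 ^ k"] by (simp add: mult_ac)
      have "2 ^ Suc k * expectation (fastest (H k)) \<le> 2 * (c * ?f k)" for k
        using times[of "H k" k] by simp
      moreover have "2 ^ Suc k * expectation (fastest (V (Suc k))) \<le> c * ?f (Suc k)"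
        "2 ^ Suc k * expectation (fastest (V' (Suc k))) \<le> c * ?f (Suc k)" for k
        by (rule times; simp)+
      ultimately show ?thesis
        by (intro add_mono mult_left_mono sum_mono) auto
    qed
    also have "\<dots> \<le> 6 * (\<Sum>k\<le>K. c * ?f k)"
      using shift by (simp add: sum_distrib_left[symmetric])
    finally show ?thesis
      by (simp add: sum_distrib_left[symmetric])
  qed
  ultimately show ?thesis
    unfolding expected_travel_le_def by blast
qed

text \<open>A journey along an axis, in either direction: the sign of \<open>l\<close> is absorbed in the chart, and a
  vertical journey exchanges the roles of rows and columns.\<close>

lemma expected_axis_travel_le:
  fixes l :: int
  assumes \<beta>: "0 < \<beta>" and c0: "0 \<le> c"
    and c: "\<And>S. finite S \<Longrightarrow> S \<noteq> {} \<Longrightarrow> S \<subseteq> integer_lines \<Longrightarrow>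
      integrable M (fastest S) \<and> expectation (fastest S) \<le> c * real (card S) powr (- 1 / \<beta>)"
  shows "\<exists>D\<ge>0. \<forall>n\<ge>2. \<forall>a b.
    expected_travel_le (a, b) (a + int n * l, b) (D * growth_rate \<beta> n) \<and>
    expected_travel_le (a, b) (a, b + int n * l) (D * growth_rate \<beta> n)"
proof (cases "l = 0")
  case True
  then show ?thesis
    by (intro exI[of _ 0]) (simp add: expected_travel_le_refl)
next
  case False
  define s where "s = sgn l"
  have s: "\<bar>s\<bar> = 1"
    using False by (simp add: s_def)
  define L where "L = nat \<bar>l\<bar>"
  have L: "1 \<le> L"
    using False by (simp add: L_def)
  obtain D where D: "0 \<le> D" "\<And>n K. 2 \<le> n \<Longrightarrow> 2 ^ K \<le> n * L \<Longrightarrow>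
      (\<Sum>k\<le>K. 2 ^ k * (2 ^ k) powr (- 1 / \<beta>)) \<le> D * growth_rate \<beta> n"
    using dyadic_sum_le_growth_rate[OF \<beta> L] by blast
  show ?thesis
  proof (intro exI[of _ "6 * c * D"] conjI allI impI)
    show "0 \<le> 6 * c * D"
      using c0 D by simp
    fix n :: nat and a b :: int assume n: "2 \<le> n"
    obtain K where K: "2 ^ K \<le> n * L" "n * L < 2 ^ Suc K"
      using ex_power_ivl1[of 2 "n * L"] n L by auto
    define m where "m = int (n * L)"
    have mK: "2 ^ K \<le> m" "m < 2 ^ Suc K"
      using K unfolding m_def by (metis of_nat_le_iff of_nat_power of_nat_numeral)
        (metis K(2) m_def of_nat_less_iff of_nat_power of_nat_numeral)
    have sm: "s * m = int n * l"
      by (simp add: s_def m_def L_def sgn_mult_abs mult.left_commute)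
    have bound: "6 * c * (\<Sum>k\<le>K. 2 ^ k * (2 ^ k) powr (- 1 / \<beta>)) \<le> 6 * c * D * growth_rate \<beta> n"
      using mult_left_mono[OF D(2)[OF n K(1)], of "6 * c"] c0 by (simp add: mult_ac)
    have shift: "inj (\<lambda>i. a + s * i)" for a
      using s by (auto intro!: injI)
    have "expected_travel_le (a + s * 0, b + 0) (a + s * m, b + 0)
        (6 * c * (\<Sum>k\<le>K. 2 ^ k * (2 ^ k) powr (- 1 / \<beta>)))"
    proof (rule expected_travel_le_dyadic_sum[where P = "\<lambda>i j. (a + s * i, b + j)"
          and h = "\<lambda>j. hline (b + j)" and v = "\<lambda>i. vline (a + s * i)", OF _ _ _ _ _ _ c0 c mK])
      show "inj (\<lambda>j. hline (b + j))"
        by (intro injI) (auto dest: injD[OF inj_hline])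
      show "inj (\<lambda>i. vline (a + s * i))"
        using inj_compose[OF inj_vline shift] by (simp add: comp_def)
      show "reachable_within t (a + s * i, b + j) (a + s * i, b + j')
          (of_int \<bar>j - j'\<bar> * t (vline (a + s * i)))" for t i j j'
        using vertical_travel[of 1 t "a + s * i" b j j'] by simp
    qed (use s horizontal_travel in auto)
    with bound sm show "expected_travel_le (a, b) (a + int n * l, b) (6 * c * D * growth_rate \<beta> n)"
      by (auto intro: expected_travel_le_mono)
    have "expected_travel_le (a + 0, b + s * 0) (a + 0, b + s * m)
        (6 * c * (\<Sum>k\<le>K. 2 ^ k * (2 ^ k) powr (- 1 / \<beta>)))"
    proof (rule expected_travel_le_dyadic_sum[where P = "\<lambda>i j. (a + j, b + s * i)"
          and h = "\<lambda>j. vline (a + j)" and v = "\<lambda>i. hline (b + s * i)", OF _ _ _ _ _ _ c0 c mK])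
      show "inj (\<lambda>j. vline (a + j))"
        by (intro injI) (auto dest: injD[OF inj_vline])
      show "inj (\<lambda>i. hline (b + s * i))"
        using inj_compose[OF inj_hline shift] by (simp add: comp_def)
      show "reachable_within t (a + j, b + s * i) (a + j', b + s * i)
          (of_int \<bar>j - j'\<bar> * t (hline (b + s * i)))" for t i j j'
        using horizontal_travel[of 1 t a j "b + s * i" j'] by simp
    qed (use s vertical_travel in auto)
    with bound sm show "expected_travel_le (a, b) (a, b + int n * l) (6 * c * D * growth_rate \<beta> n)"
      by (auto intro: expected_travel_le_mono)
  qed
qed

text \<open>Shell \<open>r\<close> costs at least the minimum over at most \<open>6 r\<close> lines, whence the constant
  $6^{-1/\beta}$.\<close>

lemma expectation_first_passage_time_ge:
  assumes int: "integrable M (\<lambda>\<omega>. first_passage_time (\<lambda>\<delta>. \<tau> \<delta> \<omega>) 0 z)"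
    and \<beta>: "0 < \<beta>" and c0: "0 \<le> c" and n: "1 \<le> n" "int n \<le> l1_norm z"
    and c: "\<And>S. finite S \<Longrightarrow> S \<noteq> {} \<Longrightarrow> S \<subseteq> integer_lines \<Longrightarrow>
      integrable M (fastest S) \<and> c * real (card S) powr (- 1 / \<beta>) \<le> expectation (fastest S)"
  shows "c * 6 powr (- 1 / \<beta>) * growth_rate \<beta> n
    \<le> expectation (\<lambda>\<omega>. first_passage_time (\<lambda>\<delta>. \<tau> \<delta> \<omega>) 0 z)"
proof -
  have cint: "integrable M (fastest (central_lines r))" for r
    using c[OF central_lines] by simp
  have "c * 6 powr (- 1 / \<beta>) * growth_rate \<beta> n
      \<le> c * 6 powr (- 1 / \<beta>) * (\<Sum>r=1..n. real r powr (- 1 / \<beta>))"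
    using c0 growth_rate_le_sum[OF \<beta> n(1)] by (intro mult_left_mono) auto
  also have "\<dots> = (\<Sum>r=1..n. c * (6 * real r) powr (- 1 / \<beta>))"
    unfolding sum_distrib_left by (intro sum.cong) (auto simp: powr_mult)
  also have "\<dots> \<le> (\<Sum>r=1..n. expectation (fastest (central_lines r)))"
  proof (rule sum_mono)
    fix r assume r: "r \<in> {1..n}"
    have card: "0 < card (central_lines r)"
      using central_lines by (simp add: card_gt_0_iff)
    have "real (card (central_lines r)) \<le> 6 * real r"
      using card_central_lines[of r] r by simp
    then have "(6 * real r) powr (- 1 / \<beta>) \<le> real (card (central_lines r)) powr (- 1 / \<beta>)"
      using \<beta> card by (intro powr_mono2') auto
    then have "c * (6 * real r) powr (- 1 / \<beta>) \<le> c * real (card (central_lines r)) powr (- 1 / \<beta>)"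
      using c0 by (rule mult_left_mono)
    also have "\<dots> \<le> expectation (fastest (central_lines r))"
      using c[OF central_lines] by simp
    finally show "c * (6 * real r) powr (- 1 / \<beta>) \<le> expectation (fastest (central_lines r))" .
  qed
  also have "\<dots> = expectation (\<lambda>\<omega>. \<Sum>r=1..n. fastest (central_lines r) \<omega>)"
    using cint by (simp add: Bochner_Integration.integral_sum)
  also have "\<dots> \<le> expectation (\<lambda>\<omega>. first_passage_time (\<lambda>\<delta>. \<tau> \<delta> \<omega>) 0 z)"
  proof (rule integral_mono)
    fix \<omega> assume \<omega>: "\<omega> \<in> space M"
    show "(\<Sum>r=1..n. fastest (central_lines r) \<omega>) \<le> first_passage_time (\<lambda>\<delta>. \<tau> \<delta> \<omega>) 0 z"
    proof (rule first_passage_time_ge)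
      fix p assume p: "p \<in> lattice_paths 0 z"
      have "(\<Sum>r=1..n. fastest (central_lines r) \<omega>)
          \<le> (\<Sum>r\<in>{nat (l1_norm 0)<..nat (l1_norm z)}. fastest (central_lines r) \<omega>)"
        using n fastest_nonneg[OF central_lines \<omega>]
        by (intro sum_mono2) (auto simp: l1_norm_def)
      also have "\<dots> \<le> path_time (\<lambda>\<delta>. \<tau> \<delta> \<omega>) p"
        unfolding fastest_def using nonneg \<omega> p by (intro path_time_ge_sum_Min) auto
      finally show "(\<Sum>r=1..n. fastest (central_lines r) \<omega>) \<le> path_time (\<lambda>\<delta>. \<tau> \<delta> \<omega>) p" .
    qed
  qed (use cint int in auto)
  finally show ?thesis .
qed

end

section \<open>The order of the expected passage time\<close>

theorem theorem1p7:
  fixes M :: "'w measure"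
    and \<tau> :: "point set \<Rightarrow> 'w \<Rightarrow> real"
    and F :: "real \<Rightarrow> real"
    and C \<beta> :: real
  assumes model: "brochette_fpp M \<tau> F"
    and inf_supp: "support_infimum F 0"
    and C: "C > 0"
    and beta: "\<beta> \<ge> 0"
    and near_0: "F \<sim>[at_right 0] (\<lambda>t. C * t powr \<beta>)"
    and bounded: "\<exists>B. \<forall>\<delta>\<in>integer_lines. AE \<omega> in M. \<tau> \<delta> \<omega> \<le> B"
    and atomless: "\<forall>\<delta>\<in>integer_lines. \<forall>t. measure (distr M borel (\<tau> \<delta>)) {t} = 0"
  shows "\<forall>x :: point. x \<noteq> 0 \<longrightarrow>
    (\<exists>A1 A2 :: real. A1 > 0 \<and> A2 > 0 \<and> (\<forall>n :: nat. n \<ge> 2 \<longrightarrow>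
      (let ET = (\<integral>\<omega>. first_passage_time (\<lambda>\<delta>. \<tau> \<delta> \<omega>) 0 (int n * fst x, int n * snd x) \<partial>M) in
        (\<beta> < 1 \<longrightarrow> A1 \<le> ET \<and> ET \<le> A2) \<and>
        (\<beta> = 1 \<longrightarrow> A1 * ln (real n) \<le> ET \<and> ET \<le> A2 * ln (real n)) \<and>
        (\<beta> > 1 \<longrightarrow> A1 * real n powr (1 - 1 / \<beta>) \<le> ET \<and> ET \<le> A2 * real n powr (1 - 1 / \<beta>)))))"
proof (intro allI impI)
  fix x :: point assume x: "x \<noteq> 0"
  interpret brochette_fpp M \<tau> F by (rule model)
  have \<beta>: "0 < \<beta>"
    using exponent_pos[OF inf_supp C beta near_0 atomless] .
  obtain B0 where B0: "\<And>\<delta>. \<delta> \<in> integer_lines \<Longrightarrow> AE \<omega> in M. \<tau> \<delta> \<omega> \<le> B0"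
    using bounded by blast
  define B where "B = max B0 1"
  have B_pos: "0 < B"
    by (simp add: B_def)
  have B: "AE \<omega> in M. \<tau> \<delta> \<omega> \<le> B" if "\<delta> \<in> integer_lines" for \<delta>
    using B0[OF that] by eventually_elim (simp add: B_def)
  obtain \<kappa> where \<kappa>: "0 < \<kappa>" "\<And>t. 0 < t \<Longrightarrow> F t \<le> \<kappa> * t powr \<beta>"
    using cdf_upper_bound[OF \<beta> C near_0] by metis
  obtain \<kappa>' where \<kappa>': "0 < \<kappa>'" "\<And>t. 0 < t \<Longrightarrow> t \<le> B \<Longrightarrow> \<kappa>' * t powr \<beta> \<le> F t"
    using cdf_lower_bound[OF \<beta> C near_0 B_pos] by metis
  define c1 where "c1 = 1 / 2 * (2 * \<kappa>) powr (- 1 / \<beta>)"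
  define c2 where "c2 = \<kappa>' powr (- 1 / \<beta>) * (1 + (\<Sum>l. exp (- (real l powr \<beta>))))"
  have c1: "0 < c1"
    using \<kappa> by (simp add: c1_def)
  have c2: "0 \<le> c2"
    unfolding c2_def using suminf_nonneg[OF summable_exp_neg_powr[OF \<beta>]] by simp
  have lower: "integrable M (fastest S) \<and> c1 * real (card S) powr (- 1 / \<beta>) \<le> expectation (fastest S)"
    if S: "finite S" "S \<noteq> {}" "S \<subseteq> integer_lines" for S
  proof
    show int: "integrable M (fastest S)"
      using S B by (rule integrable_fastest)
    show "c1 * real (card S) powr (- 1 / \<beta>) \<le> expectation (fastest S)"
      unfolding c1_def using S int \<beta> \<kappa> by (rule expectation_fastest_ge)
  qed
  have upper: "integrable M (fastest S) \<and> expectation (fastest S) \<le> c2 * real (card S) powr (- 1 / \<beta>)"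
    if S: "finite S" "S \<noteq> {}" "S \<subseteq> integer_lines" for S
  proof
    show "integrable M (fastest S)"
      using S B by (rule integrable_fastest)
    show "expectation (fastest S) \<le> c2 * real (card S) powr (- 1 / \<beta>)"
      unfolding c2_def using S B \<beta> \<kappa>' by (rule expectation_fastest_le)
  qed
  obtain D1 where D1: "0 \<le> D1" "\<And>n a b. 2 \<le> n \<Longrightarrow>
      expected_travel_le (a, b) (a + int n * fst x, b) (D1 * growth_rate \<beta> n)"
    using expected_axis_travel_le[OF \<beta> c2 upper, of "fst x"] by blast
  obtain D2 where D2: "0 \<le> D2" "\<And>n a b. 2 \<le> n \<Longrightarrow>
      expected_travel_le (a, b) (a, b + int n * snd x) (D2 * growth_rate \<beta> n)"
    using expected_axis_travel_le[OF \<beta> c2 upper, of "snd x"] by blast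
  define A1 where "A1 = c1 * 6 powr (- 1 / \<beta>)"
  define A2 where "A2 = D1 + D2 + 1"
  have bounds:
    "A1 * growth_rate \<beta> n \<le> expectation (\<lambda>\<omega>. first_passage_time (\<lambda>\<delta>. \<tau> \<delta> \<omega>) 0 (int n * fst x, int n * snd x))"
    "expectation (\<lambda>\<omega>. first_passage_time (\<lambda>\<delta>. \<tau> \<delta> \<omega>) 0 (int n * fst x, int n * snd x)) \<le> A2 * growth_rate \<beta> n"
    if n: "2 \<le> n" for n
  proof -
    let ?z = "(int n * fst x, int n * snd x)"
    have "expected_travel_le (0, 0) ?z (D1 * growth_rate \<beta> n + D2 * growth_rate \<beta> n)"
      using expected_travel_le_trans[OF D1(2)[OF n, of 0 0] D2(2)[OF n, of "0 + int n * fst x" 0]] by simp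
    then have "expected_travel_le 0 ?z (A2 * growth_rate \<beta> n)"
      using growth_rate_nonneg[of n \<beta>] n
      by (auto simp: zero_prod_def A2_def algebra_simps intro: expected_travel_le_mono)
    note T = expectation_first_passage_time_le[OF this]
    have "1 \<le> \<bar>fst x\<bar> + \<bar>snd x\<bar>"
      using x by (auto simp: prod_eq_iff)
    then have "int n * 1 \<le> int n * (\<bar>fst x\<bar> + \<bar>snd x\<bar>)"
      by (intro mult_left_mono) auto
    then have "int n \<le> l1_norm ?z"
      by (simp add: l1_norm_def abs_mult algebra_simps)
    with T(1) \<beta> c1 n lower
    show "A1 * growth_rate \<beta> n \<le> expectation (\<lambda>\<omega>. first_passage_time (\<lambda>\<delta>. \<tau> \<delta> \<omega>) 0 ?z)"
      unfolding A1_def by (intro expectation_first_passage_time_ge) auto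
    show "expectation (\<lambda>\<omega>. first_passage_time (\<lambda>\<delta>. \<tau> \<delta> \<omega>) 0 ?z) \<le> A2 * growth_rate \<beta> n"
      by (rule T(2))
  qed
  have pos: "0 < A1" "0 < A2"
    using c1 D1(1) D2(1) by (simp_all add: A1_def A2_def)
  show "\<exists>A1 A2 :: real. A1 > 0 \<and> A2 > 0 \<and> (\<forall>n :: nat. n \<ge> 2 \<longrightarrow>
      (let ET = (\<integral>\<omega>. first_passage_time (\<lambda>\<delta>. \<tau> \<delta> \<omega>) 0 (int n * fst x, int n * snd x) \<partial>M) in
        (\<beta> < 1 \<longrightarrow> A1 \<le> ET \<and> ET \<le> A2) \<and>
        (\<beta> = 1 \<longrightarrow> A1 * ln (real n) \<le> ET \<and> ET \<le> A2 * ln (real n)) \<and>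
        (\<beta> > 1 \<longrightarrow> A1 * real n powr (1 - 1 / \<beta>) \<le> ET \<and> ET \<le> A2 * real n powr (1 - 1 / \<beta>))))"
    unfolding Let_def
  proof (rule exI[of _ A1], rule exI[of _ A2], intro conjI allI impI)
  qed (use pos bounds in \<open>simp_all add: growth_rate_def\<close>)
qed

end
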